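(* For each integer $r\ge 1$ and real $c>0$ there is a constant $K$ such that the following holds for all positive integers $n,d$. If $H$ is an $r$-graph on the vertex set $[n]$ with $|H|\ge2$ edges, maximum degree $\Delta(H)\le d$ and $\varphi(H)\le c/\log n$, then \[ p_c(\mathcal{F}_H)<K d\, n^{-(r-1)}\log|H|. \]
   Context: $[n]=\{1,\dots,n\}$. An $r$-graph on $[n]$ is here a set $H$ of $r$-element subsets (edges) of $[n]$; $|H|$ is its number of edges, and $\Delta(H)$ is the maximum over vertices of the number of edges containing the vertex. $\mathcal{K}^r_n=\binom{[n]}{r}$ is the complete $r$-graph on $[n]$. $\mathcal{G}_H$ is the collection of (unlabeled) copies of $H$ in $\mathcal{K}^r_n$, i.e. sub-$r$-graphs of $\mathcal{K}_n^r$ isomorphic to $H$, regarded as subsets of $X:=\mathcal{K}^r_n$; $\mathcal{F}_H=\{T\subseteq X: T\supseteq S\text{ for some }S\in\mathcal{G}_H\}$. For an increasing (closed under supersets) family $\mathcal{F}\subseteq 2^X$, $\mathcal{F}\ne\emptyset,2^X$, the threshold $p_c(\mathcal{F})$ is the unique $p\in[0,1]$ with $\mu_p(\mathcal{F})=1/2$, where $\mu_p(\mathcal{F})=\sum_{S\in\mathcal{F}}p^{|S|}(1-p)^{|X\setminus S|}$. An $r$-graph is a forest if it contains no cycle, a cycle meaning distinct vertices $v_1,\dots,v_k$ and distinct edges $e_1,\dots,e_k$ ($k\ge2$) such that $v_{i-1},v_i\in e_i$ for all $i$ (subscripts mod $k$). For an $r$-graph $F$, $\rho(F)$ is the maximum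 size (number of edges) of a forest contained in $F$, and \[ \varphi(F)=\max\{1-\rho(F')/|F'| : \emptyset\ne F'\subseteq F\}, \] the maximum being over nonempty subsets $F'$ of the edge set of $F$. *)

theory Defs
  imports Complex_Main "HOL-Library.Ramsey"
begin

text \<open>An r-graph on a vertex set V is a set of edges \<open>H \<subseteq> [V]\<^bsup>r\<^esup>\<close>, where \<open>[V]\<^bsup>r\<^esup>\<close> is
  \<^const>\<open>nsets\<close> from \<^theory>\<open>HOL-Library.Ramsey\<close>, the family of r-element subsets of V.\<close>

definition max_degree :: "'a set \<Rightarrow> 'a set set \<Rightarrow> nat" where
  "max_degree V H = Max ((\<lambda>v. card {e \<in> H. v \<in> e}) ` V)"

definition isomorphic_on :: "'a set \<Rightarrow> 'a set set \<Rightarrow> 'a set set \<Rightarrow> bool" where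
  "isomorphic_on V H S \<longleftrightarrow> (\<exists>\<pi>. bij_betw \<pi> V V \<and> (\<lambda>e. \<pi> ` e) ` H = S)"

definition copies :: "'a set \<Rightarrow> nat \<Rightarrow> 'a set set \<Rightarrow> 'a set set set" where
  "copies V r H = {S. S \<subseteq> [V]\<^bsup>r\<^esup> \<and> isomorphic_on V H S}"

definition containing_copy :: "'a set \<Rightarrow> nat \<Rightarrow> 'a set set \<Rightarrow> 'a set set set" where
  "containing_copy V r H = {T. T \<subseteq> [V]\<^bsup>r\<^esup> \<and> (\<exists>S \<in> copies V r H. S \<subseteq> T)}"

definition mu :: "'b set \<Rightarrow> real \<Rightarrow> 'b set set \<Rightarrow> real" where
  "mu X p \<F> = (\<Sum>S\<in>\<F>. p ^ card S * (1 - p) ^ card (X - S))"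

text \<open>The description is meaningful only for an increasing family of subsets of a finite X
  other than the empty family and the full power set.\<close>

definition threshold :: "'b set \<Rightarrow> 'b set set \<Rightarrow> real" where
  "threshold X \<F> = (THE p. 0 \<le> p \<and> p \<le> 1 \<and> mu X p \<F> = 1 / 2)"

text \<open>The k vertices and the k edges are indexed by \<open>0, \<dots>, k - 1\<close>; the predecessor of i modulo k
  is written \<open>(i + k - 1) mod k\<close> because subtraction on natural numbers truncates.\<close>

definition has_cycle :: "'a set set \<Rightarrow> bool" where
  "has_cycle F \<longleftrightarrow> (\<exists>(k::nat) (v :: nat \<Rightarrow> 'a) (e :: nat \<Rightarrow> 'a set).
     k \<ge> 2 \<and> inj_on v {..<k} \<and> inj_on e {..<k} \<and>
     (\<forall>i<k. e i \<in> F \<and> v ((i + k - 1) mod k) \<in> e i \<and> v i \<in> e i))"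

definition forest :: "'a set set \<Rightarrow> bool" where
  "forest F \<longleftrightarrow> \<not> has_cycle F"

definition rho :: "'a set set \<Rightarrow> nat" where
  "rho F = Max {card T |T. T \<subseteq> F \<and> forest T}"

definition phi :: "'a set set \<Rightarrow> real" where
  "phi F = Max {1 - real (rho F') / real (card F') |F'. F' \<noteq> {} \<and> F' \<subseteq> F}"

end

theory Submission
  imports Defs "HOL-Combinatorics.Permutations"
begin

text \<open>
  The copies of \<open>H\<close> are the images \<open>(`) s ` H\<close> under permutations
  \<open>s\<close> of the \<open>n\<close> vertices, and the theorem follows from two facts about
  the family of these images.

  The first is that the family is spread: a set \<open>S\<close> of \<open>r\<close>-sets is
  contained in the image under a random permutation with probability at most
  \<open>z ^ card S\<close>, where \<open>z\<close> is a constant times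
  \<open>d / n ^ (r - 1)\<close> (\<open>permuted_copies_spread\<close>). If \<open>S\<close> were
  a forest, its edges could be attached one at a time, each sharing at most one vertex with the
  earlier ones (\<open>exists_leaf_edge\<close>). Each such edge has at most \<open>d\<close>
  images through a given vertex, against roughly \<open>n ^ (r - 1)\<close> ways to place its new
  vertices; this gives the bound for forests (\<open>card_forest_embeddings\<close>,
  \<open>card_permutations_forest\<close>). In general \<open>S\<close> may be taken to be
  isomorphic to a subgraph of \<open>H\<close>, so the hypothesis on \<^const>\<open>phi\<close>
  gives a forest in it that misses at most \<open>c * card S / ln n\<close> of its edges. Each
  missed edge costs at most a factor \<open>n ^ (r - 1)\<close>, so together they cost only a
  constant factor per edge of \<open>S\<close>.

  The second is that a spread family has a small threshold (\<open>spread_threshold\<close>): if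
  the sets have size at most \<open>l\<close> and spread \<open>z\<close>, then a random set of
  density a constant times \<open>z * ln l\<close> contains one of them with probability more than
  one half. The random set is revealed in about \<open>log\<^sub>2 l\<close> independent rounds of
  density \<open>16 * z\<close>. After a round, each set is replaced by the smallest fragment that
  still has to be covered when one may switch to any set of the family inside the union of the
  original set and the revealed elements. Park and Pham's counting of minimum fragments shows that
  few fragments exceed half the old size bound (\<open>expected_large_fragments\<close>), so the
  sizes halve until some fragment is empty (\<open>spread_avoidance\<close>). The losses of the
  rounds form a geometric series. Under the product
  measure, exchanging a set of the count for one with \<open>t\<close> more elements changes the weight by at
  most a factor \<open>(1 / p) ^ t\<close>, which the spread outweighs.
\<close>

section \<open>Random subsets and thresholds\<close>

text \<open>
  The expectation of \<open>f\<close> over the random subset of \<open>X\<close> that contains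
  each element independently with probability \<open>p\<close>; the weights are those of
  \<^const>\<open>mu\<close>.
\<close>

definition expect :: "'b set \<Rightarrow> real \<Rightarrow> ('b set \<Rightarrow> real) \<Rightarrow> real" where
  "expect X p f = (\<Sum>S\<in>Pow X. p ^ card S * (1 - p) ^ card (X - S) * f S)"

lemma expect_empty [simp]: "expect {} p f = f {}"
  by (simp add: expect_def)

text \<open>
  Conditioning on whether \<open>x\<close> is chosen. This recursion gives
  \<open>expect_Un\<close> by induction on the ground set, one element at a time.
\<close>

lemma expect_insert:
  assumes "finite X" "x \<notin> X"
  shows "expect (insert x X) p f = (1 - p) * expect X p f + p * expect X p (\<lambda>S. f (insert x S))"
proof -
  let ?w = "\<lambda>S. p ^ card S * (1 - p) ^ card (insert x X - S) * f S"
  have "expect (insert x X) p f = sum ?w (Pow X) + sum ?w (insert x ` Pow X)"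
    unfolding expect_def Pow_insert using assms
    by (intro sum.union_disjoint) auto
  moreover have "sum ?w (Pow X) = (1 - p) * expect X p f"
    unfolding expect_def sum_distrib_left
  proof (rule sum.cong)
    fix S assume "S \<in> Pow X"
    then have "insert x X - S = insert x (X - S)" "x \<notin> X - S" "finite (X - S)"
      using assms by auto
    then show "?w S = (1 - p) * (p ^ card S * (1 - p) ^ card (X - S) * f S)"
      by simp
  qed simp
  moreover have "sum ?w (insert x ` Pow X) = p * expect X p (\<lambda>S. f (insert x S))"
  proof -
    have inj: "inj_on (insert x) (Pow X)"
      using assms(2) by (intro inj_onI) (metis Diff_insert_absorb PowD insert_absorb insert_ident subsetD)
    show ?thesis
      unfolding expect_def sum_distrib_left sum.reindex[OF inj] o_def
    proof (rule sum.cong)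
      fix S assume "S \<in> Pow X"
      then have "insert x X - insert x S = X - S" "x \<notin> S" "finite S"
        using assms by (auto intro: finite_subset)
      then show "?w (insert x S) = p * (p ^ card S * (1 - p) ^ card (X - S) * f (insert x S))"
        by simp
    qed simp
  qed
  ultimately show ?thesis by simp
qed

lemma expect_add: "expect X p (\<lambda>S. f S + g S) = expect X p f + expect X p g"
  by (simp add: expect_def sum.distrib distrib_left)

lemma expect_cmult: "expect X p (\<lambda>S. a * f S) = a * expect X p f"
  by (simp add: expect_def sum_distrib_left mult_ac)

lemma expect_const [simp]: "finite X \<Longrightarrow> expect X p (\<lambda>S. a) = a"
  by (induction X rule: finite_induct) (simp_all add: expect_insert algebra_simps)

lemma expect_mono:
  assumes "0 \<le> p" "p \<le> 1" "\<And>S. S \<subseteq> X \<Longrightarrow> f S \<le> g S"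
  shows "expect X p f \<le> expect X p g"
  unfolding expect_def using assms by (intro sum_mono mult_left_mono) auto

text \<open>
  Sprinkling: each element escapes two independent random sets with probability
  \<open>(1 - p) * (1 - q)\<close>, so their union is again a random set, of density
  \<open>p + q - p * q\<close>.
\<close>

lemma expect_Un:
  assumes "finite X"
  shows "expect X p (\<lambda>A. expect X q (\<lambda>B. f (A \<union> B))) = expect X (p + q - p * q) f"
  using assms
proof (induction X arbitrary: f rule: finite_induct)
  case (insert x X)
  show ?case
    by (simp add: expect_insert insert.hyps expect_add expect_cmult insert.IH
        insert.IH[of "\<lambda>S. f (insert x S)"])
      (simp add: algebra_simps)
qed simp

lemma mu_eq_expect:
  assumes "finite X" "F \<subseteq> Pow X"
  shows "mu X p F = expect X p (\<lambda>S. of_bool (S \<in> F))"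
proof -
  have "expect X p (\<lambda>S. of_bool (S \<in> F))
      = (\<Sum>S\<in>Pow X. if S \<in> F then p ^ card S * (1 - p) ^ card (X - S) else 0)"
    unfolding expect_def by (intro sum.cong) auto
  also have "\<dots> = mu X p F"
    unfolding mu_def using assms by (subst sum.inter_restrict[symmetric]) (auto simp: Int_absorb1)
  finally show ?thesis by simp
qed

text \<open>
  The \<open>p'\<close>-random set is the \<open>p\<close>-random set \<open>W\<close> with a
  further random set sprinkled on it. As \<open>F\<close> is increasing, this keeps every
  \<open>W\<close> in \<open>F\<close>; and it moves \<open>W = {}\<close>, which is outside
  \<open>F\<close> and has positive probability, into \<open>F\<close> whenever everything is
  sprinkled.
\<close>

lemma mu_strict_mono:
  assumes X: "finite X" and F: "F \<subseteq> Pow X"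
    and up: "\<forall>S\<in>F. \<forall>T. S \<subseteq> T \<longrightarrow> T \<subseteq> X \<longrightarrow> T \<in> F"
    and nontriv: "{} \<notin> F" "X \<in> F" and p: "0 \<le> p" "p < p'" "p' \<le> 1"
  shows "mu X p F < mu X p' F"
proof -
  define q where "q = (p' - p) / (1 - p)"
  have q: "0 < q" "q \<le> 1" and qp: "q * (1 - p) = p' - p"
    using p by (auto simp: q_def field_simps)
  then have p': "p' = p + q - p * q" by (simp add: algebra_simps)
  let ?g = "\<lambda>A. expect X q (\<lambda>B. of_bool (A \<union> B \<in> F))"
  have g0: "?g A \<ge> 0" for A
    using expect_mono[of q X "\<lambda>_. 0" "\<lambda>B. of_bool (A \<union> B \<in> F)"] q X by simp
  have le: "of_bool (A \<in> F) \<le> ?g A" if "A \<subseteq> X" for A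
  proof (cases "A \<in> F")
    case True
    then have "expect X q (\<lambda>_. 1) \<le> ?g A"
      using that up q by (intro expect_mono) auto
    then show ?thesis using X True by simp
  qed (use g0 in simp)
  have pos: "0 < ?g {}"
  proof -
    have "0 < q ^ card X * (1 - q) ^ card (X - X) * of_bool ({} \<union> X \<in> F)"
      using q nontriv by simp
    also have "\<dots> \<le> ?g {}"
      unfolding expect_def using X q by (intro member_le_sum) auto
    finally show ?thesis .
  qed
  have "expect X p (\<lambda>A. of_bool (A \<in> F)) < expect X p ?g"
    unfolding expect_def[of X p]
  proof (rule sum_strict_mono_ex1)
    show "\<forall>A\<in>Pow X. p ^ card A * (1 - p) ^ card (X - A) * of_bool (A \<in> F)
        \<le> p ^ card A * (1 - p) ^ card (X - A) * ?g A"
      using p le by (intro ballI mult_left_mono) auto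
    show "\<exists>A\<in>Pow X. p ^ card A * (1 - p) ^ card (X - A) * of_bool (A \<in> F)
        < p ^ card A * (1 - p) ^ card (X - A) * ?g A"
      using p pos nontriv by (intro bexI[of _ "{}"]) auto
  qed (use X in simp)
  then show ?thesis
    using expect_Un[OF X, of p q "\<lambda>S. of_bool (S \<in> F)"] mu_eq_expect[OF X F] p' by simp
qed

text \<open>
  Strict monotonicity and the intermediate value theorem make the definite description in
  \<^const>\<open>threshold\<close> denote.
\<close>

lemma threshold_median:
  assumes X: "finite X" and F: "F \<subseteq> Pow X"
    and up: "\<forall>S\<in>F. \<forall>T. S \<subseteq> T \<longrightarrow> T \<subseteq> X \<longrightarrow> T \<in> F"
    and nontriv: "{} \<notin> F" "X \<in> F"
  shows "0 \<le> threshold X F \<and> threshold X F \<le> 1 \<and> mu X (threshold X F) F = 1 / 2"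
proof -
  have fin: "finite F" using X F finite_subset by blast
  have "mu X 0 F = 0"
    unfolding mu_def using nontriv F X by (intro sum.neutral) (auto simp: power_0_left card_eq_0_iff dest: finite_subset)
  moreover have "mu X 1 F = 1"
  proof -
    have "mu X 1 F = (\<Sum>S\<in>F. if S = X then 1 else 0)"
      unfolding mu_def using F X by (intro sum.cong) (auto simp: power_0_left)
    then show ?thesis using fin nontriv by simp
  qed
  moreover have "continuous_on {0..1} (\<lambda>p. mu X p F)"
    unfolding mu_def by (intro continuous_intros)
  ultimately obtain p where p: "0 \<le> p" "p \<le> 1" "mu X p F = 1 / 2"
    using IVT'[of "\<lambda>p. mu X p F" 0 "1/2" 1] by auto
  have "\<exists>!p. 0 \<le> p \<and> p \<le> 1 \<and> mu X p F = 1 / 2"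
  proof (rule ex1I[of _ p])
    fix p' assume "0 \<le> p' \<and> p' \<le> 1 \<and> mu X p' F = 1 / 2"
    then show "p' = p"
      using p mu_strict_mono[OF X F up nontriv, of p p'] mu_strict_mono[OF X F up nontriv, of p' p]
      by (cases p p' rule: linorder_cases) auto
  qed (use p in simp)
  then show ?thesis unfolding threshold_def by (rule theI')
qed

lemma threshold_less:
  assumes X: "finite X" and F: "F \<subseteq> Pow X"
    and up: "\<forall>S\<in>F. \<forall>T. S \<subseteq> T \<longrightarrow> T \<subseteq> X \<longrightarrow> T \<in> F"
    and nontriv: "{} \<notin> F" "X \<in> F" and q: "0 \<le> q" "q \<le> 1" "mu X q F > 1 / 2"
  shows "threshold X F < q"
proof (rule ccontr)
  assume "\<not> threshold X F < q"
  with q threshold_median[OF X F up nontriv] show False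
    using mu_strict_mono[OF X F up nontriv, of q "threshold X F"]
    by (cases "q = threshold X F") auto
qed

section \<open>Minimum fragments and the threshold of a spread family\<close>

text \<open>
  The minimum fragment of Park and Pham: among the sets \<open>G b\<close> that lie in
  \<open>W \<union> G a\<close>, one with the fewest elements outside \<open>W\<close> is chosen,
  and the fragment is what it still needs beyond \<open>W\<close>. Once \<open>W\<close> has been
  sampled, covering this fragment suffices for covering some member of the family, even though
  that member need not be \<open>G a\<close>.
\<close>

definition fragment :: "'a set \<Rightarrow> ('a \<Rightarrow> 'b set) \<Rightarrow> 'b set \<Rightarrow> 'a \<Rightarrow> 'b set" where
  "fragment A G W a = G (arg_min_on (\<lambda>b. card (G b - W)) {b \<in> A. G b \<subseteq> W \<union> G a}) - W"

lemma fragment: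
  assumes "finite A" "a \<in> A"
  shows "\<exists>b\<in>A. G b \<subseteq> W \<union> G a \<and> fragment A G W a = G b - W"
    and "\<And>b. b \<in> A \<Longrightarrow> G b \<subseteq> W \<union> G a \<Longrightarrow> card (fragment A G W a) \<le> card (G b - W)"
proof -
  let ?B = "{b \<in> A. G b \<subseteq> W \<union> G a}" and ?f = "\<lambda>b. card (G b - W)"
  have B: "finite ?B" "?B \<noteq> {}" using assms by auto
  show "\<exists>b\<in>A. G b \<subseteq> W \<union> G a \<and> fragment A G W a = G b - W"
    using arg_min_if_finite(1)[OF B, of ?f] unfolding fragment_def by blast
  show "card (fragment A G W a) \<le> card (G b - W)" if "b \<in> A" "G b \<subseteq> W \<union> G a" for b
    unfolding fragment_def using arg_min_least[OF B, of b ?f] that by auto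
qed

lemma fragment_subset: "finite A \<Longrightarrow> a \<in> A \<Longrightarrow> fragment A G W a \<subseteq> G a - W"
  using fragment(1)[of A a G W] by auto

text \<open>
  Minimality forces the fragment into every member \<open>G b\<close> that lies in
  \<open>W \<union> fragment A G W a\<close>: what \<open>G b\<close> needs beyond
  \<open>W\<close> is a part of the fragment, and cannot be a smaller one. So the union of
  \<open>W\<close> and the fragment already determines a small set that contains the fragment.
\<close>

lemma fragment_subset_witness:
  assumes "finite A" "a \<in> A" "b \<in> A" "finite (G a)" "G b \<subseteq> W \<union> fragment A G W a"
  shows "fragment A G W a \<subseteq> G b"
proof -
  have fin: "finite (fragment A G W a)"
    using fragment_subset[OF assms(1,2)] assms(4) by (meson finite_Diff finite_subset)
  have "G b - W \<subseteq> fragment A G W a" using assms(5) by auto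
  moreover have "card (fragment A G W a) \<le> card (G b - W)"
    using fragment(2)[OF assms(1,2,3), of G W] assms(5) fragment_subset[OF assms(1,2), of G W] by blast
  ultimately have "G b - W = fragment A G W a" using fin by (simp add: card_seteq)
  then show ?thesis by auto
qed

text \<open>
  Encode a pair \<open>(W, a)\<close> with fragment \<open>T\<close> of size at least
  \<open>k\<close> by the triple \<open>(Z, T, a)\<close> with \<open>Z = W \<union> T\<close>.
  The pair is recovered from the triple since \<open>T\<close> is disjoint from \<open>W\<close>.
  Given \<open>Z\<close>, there are at most \<open>2 ^ l\<close> choices for \<open>T\<close>, as
  it lies in a member of the family that is determined by \<open>Z\<close>; given
  \<open>T\<close>, the spread bounds the number of \<open>a\<close> by
  \<open>M * z ^ card T\<close>. Passing from \<open>Z\<close> to \<open>Z - T\<close> raises the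
  weight by at most \<open>(1 / p) ^ card T\<close>. So every \<open>Z\<close> contributes at most
  its own probability times \<open>M * (2 ^ l * (z / p) ^ k)\<close>.
\<close>

lemma expected_large_fragments:
  fixes z p M :: real
  assumes X: "finite X" and A: "finite A"
    and G: "\<And>a. a \<in> A \<Longrightarrow> G a \<subseteq> X \<and> card (G a) \<le> l"
    and spread: "\<And>U. U \<subseteq> X \<Longrightarrow> card {a \<in> A. U \<subseteq> G a} \<le> M * z ^ card U"
    and p: "0 \<le> z" "z \<le> p" "0 < p" "p \<le> 1"
  shows "expect X p (\<lambda>W. card {a \<in> A. k \<le> card (fragment A G W a)}) \<le> M * (2 ^ l * (z / p) ^ k)"
proof -
  define w where "w S = p ^ card S * (1 - p) ^ card (X - S)" for S
  \<comment> \<open>A member of the family inside \<open>Z\<close>, chosen as a function of \<open>Z\<close> only.\<close>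
  define g where "g Z = (if \<exists>b\<in>A. G b \<subseteq> Z then G (SOME b. b \<in> A \<and> G b \<subseteq> Z) else {})" for Z
  have g: "\<exists>b\<in>A. G b \<subseteq> Z \<and> g Z = G b" if "\<exists>b\<in>A. G b \<subseteq> Z" for Z
    using someI_ex[of "\<lambda>b. b \<in> A \<and> G b \<subseteq> Z"] that unfolding g_def by auto
  have gZ: "g Z \<subseteq> Z \<and> card (g Z) \<le> l" for Z
    using g[of Z] G by (cases "\<exists>b\<in>A. G b \<subseteq> Z") (auto simp: g_def)
  have M0: "0 \<le> M" using spread[of "{}"] by simp
  define I where "I = (SIGMA W:Pow X. {a \<in> A. k \<le> card (fragment A G W a)})"
  define J where "J = (SIGMA Z:Pow X. SIGMA T:{T. T \<subseteq> g Z \<and> k \<le> card T}. {a \<in> A. T \<subseteq> G a})"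
  define h where "h = (\<lambda>(W, a). (W \<union> fragment A G W a, fragment A G W a, a))"
  have finT: "finite {T. T \<subseteq> g Z \<and> k \<le> card T}" if "Z \<subseteq> X" for Z
  proof (rule finite_subset)
    show "{T. T \<subseteq> g Z \<and> k \<le> card T} \<subseteq> Pow X" using that gZ[of Z] by blast
  qed (use X in simp)
  have finJ: "finite J"
    unfolding J_def using X A finT by (intro finite_SigmaI) auto
  have inj: "inj_on h I"
  proof (rule inj_onI)
    fix x y assume *: "x \<in> I" "y \<in> I" "h x = h y"
    obtain W a V b where xy: "x = (W, a)" "y = (V, b)" by fastforce
    have "W \<inter> fragment A G W a = {}" "V \<inter> fragment A G V b = {}"
      using * fragment_subset[OF A, of a G W] fragment_subset[OF A, of b G V]
      unfolding I_def xy by blast+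
    then show "x = y" using *(3) unfolding xy h_def by auto
  qed
  have sub: "h ` I \<subseteq> J"
  proof (clarsimp simp: I_def J_def h_def)
    fix W a assume *: "W \<subseteq> X" "a \<in> A" "k \<le> card (fragment A G W a)"
    let ?T = "fragment A G W a"
    note fr = fragment_subset[OF A *(2), of G W] and Ga = G[OF *(2)]
    obtain b where b: "b \<in> A" "?T = G b - W" using fragment(1)[OF A *(2), of G W] by blast
    then have "\<exists>b\<in>A. G b \<subseteq> W \<union> ?T" by (intro bexI[of _ b]) auto
    then obtain b' where b': "b' \<in> A" "G b' \<subseteq> W \<union> ?T" "g (W \<union> ?T) = G b'"
      using g by blast
    have "?T \<subseteq> g (W \<union> ?T)"
      using fragment_subset_witness[OF A *(2) b'(1) _ b'(2)] b'(3) Ga X by (metis finite_subset)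
    then show "?T \<subseteq> X \<and> ?T \<subseteq> g (W \<union> ?T) \<and> ?T \<subseteq> G a" using fr Ga by blast
  qed
  have w: "w (Z - T) * p ^ card T \<le> w Z" if "Z \<subseteq> X" "T \<subseteq> Z" for Z T
  proof -
    have "finite Z" using that X finite_subset by auto
    then have "card Z = card (Z - T) + card T"
      using that by (metis card_Diff_subset card_mono finite_subset le_add_diff_inverse2)
    moreover have "card (X - Z) \<le> card (X - (Z - T))" using that X by (intro card_mono) auto
    then have "(1 - p) ^ card (X - (Z - T)) \<le> (1 - p) ^ card (X - Z)"
      using p by (intro power_decreasing) auto
    ultimately show ?thesis using p unfolding w_def
      by (simp add: power_add mult_ac mult_left_mono)
  qed
  have "expect X p (\<lambda>W. card {a \<in> A. k \<le> card (fragment A G W a)})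
      = (\<Sum>W\<in>Pow X. \<Sum>a\<in>{a \<in> A. k \<le> card (fragment A G W a)}. w W)"
    unfolding expect_def w_def by (simp add: mult_ac)
  also have "\<dots> = (\<Sum>(W, a)\<in>I. w W)"
    unfolding I_def using X A by (subst sum.Sigma) auto
  also have "\<dots> = (\<Sum>x\<in>I. (\<lambda>(Z, T, a). w (Z - T)) (h x))"
  proof (rule sum.cong)
    fix x assume "x \<in> I"
    then obtain W a where x: "x = (W, a)" "a \<in> A" unfolding I_def by auto
    have "W \<union> fragment A G W a - fragment A G W a = W"
      using fragment_subset[OF A x(2), of G W] by auto
    then show "(case x of (W, a) \<Rightarrow> w W) = (\<lambda>(Z, T, a). w (Z - T)) (h x)"
      unfolding h_def x by simp
  qed simp
  also have "\<dots> = (\<Sum>(Z, T, a)\<in>h ` I. w (Z - T))"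
    using sum.reindex[OF inj, of "\<lambda>(Z, T, a). w (Z - T)"] by (simp add: o_def)
  also have "\<dots> \<le> (\<Sum>(Z, T, a)\<in>J. w (Z - T))"
    using p finJ sub by (intro sum_mono2) (auto simp: w_def)
  also have "\<dots> = (\<Sum>Z\<in>Pow X. \<Sum>T\<in>{T. T \<subseteq> g Z \<and> k \<le> card T}. \<Sum>a\<in>{a \<in> A. T \<subseteq> G a}. w (Z - T))"
  proof -
    have "(\<Sum>Z\<in>Pow X. \<Sum>T\<in>{T. T \<subseteq> g Z \<and> k \<le> card T}. \<Sum>a\<in>{a \<in> A. T \<subseteq> G a}. w (Z - T))
      = (\<Sum>Z\<in>Pow X. \<Sum>(T, a)\<in>(SIGMA T:{T. T \<subseteq> g Z \<and> k \<le> card T}. {a \<in> A. T \<subseteq> G a}). w (Z - T))"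
      using A finT by (intro sum.cong sum.Sigma) auto
    also have "\<dots> = (\<Sum>(Z, T, a)\<in>J. w (Z - T))"
      unfolding J_def using X A finT by (subst sum.Sigma) (auto simp: split_def)
    finally show ?thesis by simp
  qed
  also have "\<dots> \<le> (\<Sum>Z\<in>Pow X. w Z * (M * (2 ^ l * (z / p) ^ k)))"
  proof (rule sum_mono)
    fix Z assume Z: "Z \<in> Pow X"
    have fg: "finite (g Z)" using gZ[of Z] Z X by (meson PowD finite_subset)
    have "(\<Sum>T\<in>{T. T \<subseteq> g Z \<and> k \<le> card T}. \<Sum>a\<in>{a \<in> A. T \<subseteq> G a}. w (Z - T))
        \<le> (\<Sum>T\<in>{T. T \<subseteq> g Z \<and> k \<le> card T}. w Z * (M * (z / p) ^ k))"
    proof (rule sum_mono)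
      fix T assume T: "T \<in> {T. T \<subseteq> g Z \<and> k \<le> card T}"
      then have TX: "T \<subseteq> Z" "T \<subseteq> X" using gZ[of Z] Z by auto
      have "(\<Sum>a\<in>{a \<in> A. T \<subseteq> G a}. w (Z - T)) = card {a \<in> A. T \<subseteq> G a} * w (Z - T)" by simp
      also have "\<dots> \<le> (M * z ^ card T) * w (Z - T)"
        using spread[OF TX(2)] p by (intro mult_right_mono) (auto simp: w_def)
      also have "\<dots> = M * (z / p) ^ card T * (w (Z - T) * p ^ card T)"
        using p by (simp add: power_divide)
      also have "\<dots> \<le> M * (z / p) ^ card T * w Z"
        using M0 p w[of Z T] Z TX by (intro mult_left_mono) auto
      also have "\<dots> \<le> M * (z / p) ^ k * w Z"
        using T M0 p by (intro mult_right_mono mult_left_mono power_decreasing) (auto simp: w_def)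
      finally show "(\<Sum>a\<in>{a \<in> A. T \<subseteq> G a}. w (Z - T)) \<le> w Z * (M * (z / p) ^ k)"
        by (simp add: mult_ac)
    qed
    also have "\<dots> = card {T. T \<subseteq> g Z \<and> k \<le> card T} * (w Z * (M * (z / p) ^ k))" by simp
    also have "\<dots> \<le> 2 ^ l * (w Z * (M * (z / p) ^ k))"
    proof (rule mult_right_mono)
      have "card {T. T \<subseteq> g Z \<and> k \<le> card T} \<le> card (Pow (g Z))"
        using fg by (intro card_mono) auto
      also have "\<dots> \<le> 2 ^ l" using gZ[of Z] fg by (simp add: card_Pow)
      finally have "real (card {T. T \<subseteq> g Z \<and> k \<le> card T}) \<le> real (2 ^ l)"
        by (simp only: of_nat_le_iff)
      then show "real (card {T. T \<subseteq> g Z \<and> k \<le> card T}) \<le> 2 ^ l" by simp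
      show "0 \<le> w Z * (M * (z / p) ^ k)" using M0 p by (simp add: w_def)
    qed
    finally show "(\<Sum>T\<in>{T. T \<subseteq> g Z \<and> k \<le> card T}. \<Sum>a\<in>{a \<in> A. T \<subseteq> G a}. w (Z - T))
        \<le> w Z * (M * (2 ^ l * (z / p) ^ k))" by (simp add: mult_ac)
  qed
  also have "\<dots> = M * (2 ^ l * (z / p) ^ k)"
    using expect_const[OF X, of p "M * (2 ^ l * (z / p) ^ k)"] unfolding expect_def w_def by simp
  finally show ?thesis .
qed

text \<open>
  One round samples a random set \<open>W\<close> of density \<open>16 * z\<close> and replaces
  every \<open>G a\<close> by its fragment. The indices whose fragments have not been halved are
  dropped; for sets of size below \<open>2 ^ Suc m\<close> they number at most
  \<open>M * (1 / 4) ^ Suc m\<close> on average. Fragments are subsets of the original sets, so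
  they inherit the spread with the same \<open>M\<close>. After \<open>m\<close> rounds all
  remaining sets are empty.

  The failure probability is multiplied by the number of indices because in this form the loss
  from dropped indices is additive from round to round. The bound \<open>M\<close> in the spread
  is kept apart from \<open>card A\<close>, which shrinks.
\<close>

lemma spread_avoidance:
  fixes z M :: real
  assumes X: "finite X" and z: "0 < z" "16 * z \<le> 1"
    and "finite A" "\<And>a. a \<in> A \<Longrightarrow> G a \<subseteq> X \<and> card (G a) < 2 ^ m"
    and "\<And>U. U \<subseteq> X \<Longrightarrow> card {a \<in> A. U \<subseteq> G a} \<le> M * z ^ card U"
  shows "card A * expect X (1 - (1 - 16 * z) ^ m) (\<lambda>W. of_bool (\<forall>a\<in>A. \<not> G a \<subseteq> W))
      \<le> M * (\<Sum>j=1..m. (1 / 4) ^ j)"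
  using assms(4-6)
proof (induction m arbitrary: A G)
  case 0
  then have "G a = {}" if "a \<in> A" for a
    using that X by (metis finite_subset card_0_eq less_one power_0)
  then show ?case
    by (cases "A = {}") (use X in \<open>auto simp: expect_def\<close>)
next
  case (Suc m)
  define p where "p = 16 * z"
  define q where "q = 1 - (1 - p) ^ m"
  have p: "0 < p" "p \<le> 1" using z by (auto simp: p_def)
  then have q: "0 \<le> q" "q \<le> 1" by (auto simp: q_def power_le_one)
  have pq: "1 - (1 - p) ^ Suc m = p + q - p * q" by (simp add: q_def algebra_simps)
  define S where "S W = {a \<in> A. card (fragment A G W a) < 2 ^ m}" for W
  define L where "L W = {a \<in> A. 2 ^ m \<le> card (fragment A G W a)}" for W
  define miss where "miss A' G' W = (of_bool (\<forall>a\<in>A'. \<not> (G'::'b \<Rightarrow> 'a set) a \<subseteq> W) :: real)" for A' G' W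
  define P where "P W = expect X q (miss (S W) (fragment A G W))" for W
  have miss01: "0 \<le> miss A' G' W" "miss A' G' W \<le> 1" for A' G' W by (auto simp: miss_def)
  have P1: "P W \<le> 1" for W
    unfolding P_def using expect_mono[of q X _ "\<lambda>_. 1"] q X miss01(2) by simp
  have split: "card A = card (S W) + card (L W)" for W
  proof -
    have "A = S W \<union> L W" "S W \<inter> L W = {}" by (auto simp: S_def L_def)
    then show ?thesis using Suc.prems(1) by (metis card_Un_disjoint finite_Un)
  qed
  have small: "card (S W) * P W \<le> M * (\<Sum>j=1..m. (1 / 4) ^ j)" for W
    unfolding P_def q_def p_def miss_def
  proof (rule Suc.IH)
    show "finite (S W)" using Suc.prems(1) by (simp add: S_def)
    show "fragment A G W a \<subseteq> X \<and> card (fragment A G W a) < 2 ^ m" if "a \<in> S W" for a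
      using that fragment_subset[OF Suc.prems(1), of a G W] Suc.prems(2)[of a] by (auto simp: S_def)
    fix U assume U: "U \<subseteq> X"
    have "card {a \<in> S W. U \<subseteq> fragment A G W a} \<le> card {a \<in> A. U \<subseteq> G a}"
      using Suc.prems(1) fragment_subset[OF Suc.prems(1), of _ G W]
      by (intro card_mono) (auto simp: S_def)
    then show "card {a \<in> S W. U \<subseteq> fragment A G W a} \<le> M * z ^ card U"
      using Suc.prems(3)[OF U] by linarith
  qed
  have large: "expect X p (\<lambda>W. card (L W)) \<le> M * (1 / 4) ^ Suc m"
  proof -
    have M0: "0 \<le> M" using Suc.prems(3)[of "{}"] by simp
    have "expect X p (\<lambda>W. card (L W)) \<le> M * (2 ^ (2 * 2 ^ m) * (z / p) ^ (2 ^ m))"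
      unfolding L_def
      by (rule expected_large_fragments) (use X Suc.prems p z in \<open>auto simp: p_def less_imp_le\<close>)
    \<comment> \<open>The density \<open>16 * z\<close> makes \<open>4 * (z / p) = 1 / 4\<close>, where \<open>4 = 2\<^sup>2\<close> pays for the choice of \<open>T\<close>
      in a set of size at most \<open>2 * 2 ^ m\<close>.\<close>
    also have "2 ^ (2 * 2 ^ m) * (z / p) ^ (2 ^ m) = (1 / 4 :: real) ^ (2 ^ m)"
      using z by (simp add: p_def power_mult flip: power_mult_distrib)
    also have "M * (1 / 4 :: real) ^ (2 ^ m) \<le> M * (1 / 4) ^ Suc m"
      using M0 less_exp[of m] by (intro mult_left_mono power_decreasing Suc_leI) auto
    finally show ?thesis .
  qed
  have "card A * expect X (1 - (1 - p) ^ Suc m) (miss A G)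
      = card A * expect X p (\<lambda>W. expect X q (\<lambda>V. miss A G (W \<union> V)))"
    unfolding pq expect_Un[OF X] by simp
  also have "\<dots> \<le> card A * expect X p P"
  proof (intro mult_left_mono expect_mono)
    fix W
    show "expect X q (\<lambda>V. miss A G (W \<union> V)) \<le> P W"
      unfolding P_def
    proof (rule expect_mono[OF q])
      fix V
      show "miss A G (W \<union> V) \<le> miss (S W) (fragment A G W) V"
      proof (cases "\<exists>a\<in>S W. fragment A G W a \<subseteq> V")
        case True
        then obtain a where a: "a \<in> A" "fragment A G W a \<subseteq> V" by (auto simp: S_def)
        obtain b where "b \<in> A" "fragment A G W a = G b - W"
          using fragment(1)[OF Suc.prems(1) a(1), of G W] by blast
        then have "G b \<subseteq> W \<union> V" using a by auto
        then have "miss A G (W \<union> V) = 0" using \<open>b \<in> A\<close> by (auto simp: miss_def)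
        then show ?thesis using miss01(1) by simp
      qed (simp add: miss_def)
    qed
  qed (use p in auto)
  also have "\<dots> = expect X p (\<lambda>W. card A * P W)" by (simp add: expect_cmult)
  also have "\<dots> \<le> expect X p (\<lambda>W. M * (\<Sum>j=1..m. (1 / 4) ^ j) + card (L W))"
  proof (rule expect_mono)
    fix W
    have "card A * P W = card (S W) * P W + card (L W) * P W"
      unfolding split[of W] by (simp add: distrib_right)
    also have "\<dots> \<le> M * (\<Sum>j=1..m. (1 / 4) ^ j) + real (card (L W)) * 1"
      using P1[of W] small[of W] by (intro add_mono mult_left_mono) auto
    finally show "card A * P W \<le> M * (\<Sum>j=1..m. (1 / 4) ^ j) + card (L W)" by simp
  qed (use p in auto)
  also have "\<dots> = M * (\<Sum>j=1..m. (1 / 4) ^ j) + expect X p (\<lambda>W. card (L W))"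
    using X by (simp add: expect_add)
  also have "\<dots> \<le> M * (\<Sum>j=1..Suc m. (1 / 4) ^ j)"
    using large by (simp add: distrib_left)
  finally show ?case by (simp only: p_def miss_def[abs_def])
qed

lemma sum_quarter_powers: "(\<Sum>j=1..m. (1 / 4 :: real) ^ j) = (1 - (1 / 4) ^ m) / 3"
  by (induction m) (simp_all add: diff_divide_distrib)

lemma half_le_ln_2: "1 / 2 \<le> ln (2 :: real)"
  using ln_le_minus_one[of "1 / 2"] by (simp add: ln_div)

text \<open>
  A family of sets of size at most \<open>l\<close> with spread \<open>z\<close> has a member
  covered after about \<open>log\<^sub>2 l\<close> rounds of density \<open>16 * z\<close>, with
  failure probability at most \<open>1 / 4 + 1 / 16 + \<dots> = 1 / 3\<close>. When
  \<open>16 * z > 1\<close> there is no such density and the bound exceeds 1, so the spread is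
  demanded only for \<open>16 * z \<le> 1\<close>.
\<close>

lemma spread_threshold:
  fixes z :: real
  assumes X: "finite X" and F: "F \<subseteq> Pow X"
    and up: "\<forall>S\<in>F. \<forall>T. S \<subseteq> T \<longrightarrow> T \<subseteq> X \<longrightarrow> T \<in> F"
    and nontriv: "{} \<notin> F" "X \<in> F"
    and A: "finite A" "A \<noteq> {}" and G: "\<And>a. a \<in> A \<Longrightarrow> G a \<in> F \<and> card (G a) \<le> l" and l: "l \<ge> 2"
    and z: "0 < z" and spread: "\<And>U. U \<subseteq> X \<Longrightarrow> 16 * z \<le> 1 \<Longrightarrow> card {a \<in> A. U \<subseteq> G a} \<le> card A * z ^ card U"
  shows "threshold X F < 64 * z * ln l"
proof -
  have ln_l: "ln 2 \<le> ln (real l)" using l by simp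
  show ?thesis
  proof (cases "16 * z \<le> 1")
    case False
    have "threshold X F \<le> 1" using threshold_median[OF X F up nontriv] by simp
    also have "1 < 64 * z * (1 / 2)" using False by simp
    also have "\<dots> \<le> 64 * z * ln l" using ln_l half_le_ln_2 z by (intro mult_left_mono) auto
    finally show ?thesis .
  next
    case True
    obtain k where k: "2 ^ k \<le> l" "l < 2 ^ (k + 1)" using ex_power_ivl1[of 2 l] l by auto
    define q where "q = 1 - (1 - 16 * z) ^ (k + 1)"
    have q: "0 \<le> q" "q \<le> 1" using z True by (auto simp: q_def power_le_one simp del: power_Suc)
    have "1 + real (k + 1) * (- (16 * z)) \<le> (1 + - (16 * z)) ^ (k + 1)"
      using True by (intro Bernoulli_inequality) auto
    then have qk: "q \<le> 16 * z * real (k + 1)" by (simp add: q_def algebra_simps)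
    have "real (k + 1) \<le> 4 * ln l"
    proof -
      have "real (2 ^ k) \<le> real l" using k(1) by (simp only: of_nat_le_iff)
      then have "(2 :: real) ^ k \<le> real l" by simp
      then have "ln (2 ^ k) \<le> ln (real l)" using l by simp
      moreover have "real k * ln 2 = ln (2 ^ k)" by (simp add: ln_realpow)
      ultimately have "real (k + 1) * ln 2 \<le> 2 * ln l" using ln_l by (simp add: algebra_simps)
      moreover have "real (k + 1) * (1 / 2) \<le> real (k + 1) * ln 2"
        using half_le_ln_2 by (intro mult_left_mono) auto
      ultimately have "real (k + 1) * (1 / 2) \<le> 2 * ln l" by (rule order_trans[rotated])
      then show ?thesis by simp
    qed
    then have "16 * z * real (k + 1) \<le> 16 * z * (4 * ln l)" using z by (intro mult_left_mono) auto
    with qk have ql: "q \<le> 64 * z * ln l" by simp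
    let ?miss = "\<lambda>W. of_bool (\<forall>a\<in>A. \<not> G a \<subseteq> W) :: real"
    have "card A * expect X q ?miss \<le> card A * (\<Sum>j=1..k + 1. (1 / 4) ^ j)"
      unfolding q_def
    proof (rule spread_avoidance[OF X z True A(1)])
      show "G a \<subseteq> X \<and> card (G a) < 2 ^ (k + 1)" if "a \<in> A" for a
        using G[OF that] F k(2) by auto
    qed (use spread True in simp)
    then have "expect X q ?miss \<le> (\<Sum>j=1..k + 1. (1 / 4) ^ j)"
      using A by (simp add: card_gt_0_iff)
    also have "\<dots> \<le> 1 / 3" unfolding sum_quarter_powers by simp
    finally have miss: "expect X q ?miss \<le> 1 / 3" .
    have "1 = expect X q (\<lambda>_. 1)" using X by simp
    also have "\<dots> \<le> expect X q (\<lambda>W. ?miss W + of_bool (W \<in> F))"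
      using up G by (intro expect_mono q) (auto simp: of_bool_def)
    also have "\<dots> = expect X q ?miss + mu X q F" by (simp only: expect_add mu_eq_expect[OF X F])
    finally have "1 / 2 < mu X q F"
      using miss by linarith
    then have "threshold X F < q" by (rule threshold_less[OF X F up nontriv q])
    then show ?thesis using ql by simp
  qed
qed

section \<open>Forests\<close>

text \<open>
  If every edge had two vertices on other edges, then the last edge of a longest path of edges
  would have a vertex \<open>x\<close>, different from the vertex through which the path entered
  it, that lies on a further edge. If \<open>x\<close> lies on an earlier edge of the path, the
  last such edge closes a cycle with the end of the path; if not, the path can be prolonged.
\<close>

lemma exists_leaf_edge:
  assumes T: "finite T" "T \<noteq> {}" and forest: "forest T"
  shows "\<exists>e\<in>T. \<forall>u\<in>e \<inter> \<Union>(T - {e}). \<forall>v\<in>e \<inter> \<Union>(T - {e}). u = v"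
proof (rule ccontr)
  assume "\<not> ?thesis"
  then have two: "\<exists>u\<in>e \<inter> \<Union>(T - {e}). \<exists>v\<in>e \<inter> \<Union>(T - {e}). u \<noteq> v" if "e \<in> T" for e
    using that by (simp only: bex_simps ball_simps not_True_eq_False simp_thms)
  \<comment> \<open>Consecutive edges \<open>e i\<close> and \<open>e (Suc i)\<close> are joined by the vertex \<open>v i\<close>.\<close>
  define path where "path k e v \<longleftrightarrow> inj_on e {..k} \<and> inj_on v {..<k} \<and> e ` {..k} \<subseteq> T \<and>
     (\<forall>i<k. v i \<in> e i \<and> v i \<in> e (Suc i))" for k :: nat and e :: "nat \<Rightarrow> 'a set" and v :: "nat \<Rightarrow> 'a"
  have ex0: "\<exists>e v. path 0 e v"
  proof -
    obtain e0 where "e0 \<in> T" using T by auto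
    then have "path 0 (\<lambda>_. e0) (\<lambda>_. undefined)" by (auto simp: path_def)
    then show ?thesis by blast
  qed
  have bound: "k \<le> card T" if "\<exists>e v. path k e v" for k
  proof -
    obtain e v where "path k e v" using \<open>\<exists>e v. path k e v\<close> by blast
    then have "inj_on e {..k}" "e ` {..k} \<subseteq> T" by (auto simp: path_def)
    then have "card {..k} \<le> card T" using T by (intro card_inj_on_le)
    then show ?thesis by simp
  qed
  obtain k where k: "\<exists>e v. path k e v" "\<And>j. \<exists>e v. path j e v \<Longrightarrow> j \<le> k"
    using ex_has_greatest_nat[of "\<lambda>k. \<exists>e v. path k e v" 0 "\<lambda>k. k" "Suc (card T)"] ex0 bound
    by (metis le_imp_less_Suc)
  then obtain e v where path: "path k e v" by blast
  then have e: "inj_on e {..k}" and v: "inj_on v {..<k}" and eT: "\<And>i. i \<le> k \<Longrightarrow> e i \<in> T"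
    and ve: "\<And>i. i < k \<Longrightarrow> v i \<in> e i" "\<And>i. i < k \<Longrightarrow> v i \<in> e (Suc i)"
    by (auto simp: path_def)
  obtain x where x: "x \<in> e k" "x \<in> \<Union>(T - {e k})" "k > 0 \<Longrightarrow> x \<noteq> v (k - 1)"
    using two[OF eT[of k]] by (cases "k > 0") auto
  obtain f where f: "f \<in> T" "f \<noteq> e k" "x \<in> f" using x by auto
  define v' where "v' = v(k := x)"
  show False
  proof (cases "\<exists>s<k. x \<in> e s")
    case True
    \<comment> \<open>The last choice of \<open>s\<close> keeps \<open>x\<close> distinct from the path vertices of the cycle.\<close>
    define s where "s = Max {s. s < k \<and> x \<in> e s}"
    have fin: "finite {s. s < k \<and> x \<in> e s}" by simp
    have s: "s < k" "x \<in> e s"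
      using Max_in[OF fin] True unfolding s_def by auto
    have smax: "x \<notin> e t" if "s < t" "t < k" for t
    proof
      assume "x \<in> e t"
      then have "t \<le> s" unfolding s_def using that by (intro Max_ge[OF fin]) auto
      then show False using that by simp
    qed
    have xv: "x \<noteq> v i" if "s \<le> i" "i < k" for i
    proof (cases "Suc i = k")
      case True then show ?thesis using x(3) by auto
    next
      case False then show ?thesis using smax[of "Suc i"] ve(2)[of i] that by auto
    qed
    let ?l = "Suc (k - s)"
    have "inj_on (\<lambda>j. v' (s + j)) {..<?l}"
    proof (rule inj_onI)
      fix i j assume *: "i \<in> {..<?l}" "j \<in> {..<?l}" "v' (s + i) = v' (s + j)"
      then show "i = j"
        using xv[of "s + i"] xv[of "s + j"] inj_onD[OF v, of "s + i" "s + j"] s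
        by (auto simp: v'_def split: if_splits)
    qed
    moreover have "inj_on (\<lambda>j. e (s + j)) {..<?l}"
    proof (rule inj_onI)
      fix i j assume *: "i \<in> {..<?l}" "j \<in> {..<?l}" "e (s + i) = e (s + j)"
      then have "s + i = s + j" using s by (intro inj_onD[OF e]) auto
      then show "i = j" by simp
    qed
    moreover have "e (s + i) \<in> T \<and> v' (s + (i + ?l - 1) mod ?l) \<in> e (s + i) \<and> v' (s + i) \<in> e (s + i)"
      if "i < ?l" for i
    proof (intro conjI)
      show "e (s + i) \<in> T" using that s by (intro eT) auto
      show "v' (s + i) \<in> e (s + i)"
        using that s x ve(1)[of "s + i"] by (auto simp: v'_def)
      show "v' (s + (i + ?l - 1) mod ?l) \<in> e (s + i)"
      proof (cases i)
        case 0 then show ?thesis using s by (simp add: v'_def)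
      next
        case (Suc j)
        then have "i + ?l - 1 = j + ?l" "j < ?l" using that by auto
        then have "(i + ?l - 1) mod ?l = j" by (simp only: mod_add_self2 mod_less)
        then show ?thesis using ve(2)[of "s + j"] Suc that by (auto simp: v'_def)
      qed
    qed
    ultimately have "has_cycle T"
      unfolding has_cycle_def using s
      by (intro exI[of _ ?l] exI[of _ "\<lambda>j. v' (s + j)"] exI[of _ "\<lambda>j. e (s + j)"]) auto
    then show False using forest by (simp add: forest_def)
  next
    case False
    have fe: "f \<noteq> e i" if "i \<le> k" for i
      using False f that by (cases "i = k") auto
    have xv: "x \<noteq> v i" if "i < k" for i using False ve(1)[of i] that by auto
    have "inj_on (e(Suc k := f)) {..Suc k}"
      using fe e unfolding inj_on_def by (auto simp: le_Suc_eq) metis+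
    moreover have "inj_on v' {..<Suc k}"
      using xv v unfolding v'_def inj_on_def by (auto simp: less_Suc_eq) (blast+)
    ultimately have "path (Suc k) (e(Suc k := f)) v'"
      unfolding path_def using eT f ve x by (auto simp: v'_def le_Suc_eq less_Suc_eq)
    then show False using k(2)[of "Suc k"] by auto
  qed
qed

section \<open>Counting embeddings of forests\<close>

definition embeddings :: "'b set \<Rightarrow> 'a set \<Rightarrow> 'a set set \<Rightarrow> 'b set set \<Rightarrow> ('a \<Rightarrow> 'b) set" where
  "embeddings N V T H = {f \<in> V \<rightarrow>\<^sub>E N. inj_on f V \<and> (\<forall>e\<in>T. f ` e \<in> H)}"

lemma card_extensions_le:
  assumes "finite E" "\<And>D. D \<in> E \<Longrightarrow> card D = r" "finite e" "card e = r"
  shows "card (\<Union>D\<in>E. e \<rightarrow>\<^sub>E D) \<le> card E * r ^ r"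
proof -
  have "card (\<Union>D\<in>E. e \<rightarrow>\<^sub>E D) \<le> (\<Sum>D\<in>E. card (e \<rightarrow>\<^sub>E D))"
    using assms by (intro card_UN_le) 
  also have "\<dots> = (\<Sum>D\<in>E. r ^ r)"
    using assms by (intro sum.cong) (auto simp: card_PiE)
  finally show ?thesis by simp
qed

lemma card_edges_le:
  assumes "finite V" "r \<ge> 1" "H \<subseteq> [V]\<^bsup>r\<^esup>" "\<forall>v\<in>V. card {e \<in> H. v \<in> e} \<le> d"
  shows "card H \<le> card V * d"
proof -
  have "finite H" using assms by (meson finite_imp_finite_nsets finite_subset)
  have "H \<subseteq> (\<Union>v\<in>V. {e \<in> H. v \<in> e})"
  proof
    fix e assume "e \<in> H"
    then have "e \<subseteq> V" "card e = r" using assms(3) by (auto simp: nsets_def)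
    then have "e \<noteq> {}" using assms(2) by auto
    then show "e \<in> (\<Union>v\<in>V. {e \<in> H. v \<in> e})" using \<open>e \<subseteq> V\<close> \<open>e \<in> H\<close> by auto
  qed
  then have "card H \<le> card (\<Union>v\<in>V. {e \<in> H. v \<in> e})"
    using \<open>finite H\<close> assms(1) by (intro card_mono) auto
  also have "\<dots> \<le> (\<Sum>v\<in>V. card {e \<in> H. v \<in> e})" using assms(1) by (rule card_UN_le)
  also have "\<dots> \<le> card V * d" using sum_bounded_above[of V _ d] assms(4) by simp
  finally show ?thesis .
qed

lemma has_cycle_mono: "has_cycle S \<Longrightarrow> S \<subseteq> T \<Longrightarrow> has_cycle T"
  unfolding has_cycle_def by blast

text \<open>
  Read as a probability, the bound says that each edge costs a factor
  \<open>d * r ^ r / n ^ (r - 1)\<close> among the \<open>n ^ card (\<Union>T)\<close> maps of the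
  vertices, where \<open>n = card N\<close>. Attach the edges in the reverse of the order in which
  leaf edges are removed. An edge that meets the earlier ones in one vertex brings
  \<open>r - 1\<close> new vertices, and its image is one of at most \<open>d\<close> edges
  through the image of that vertex. An edge disjoint from the earlier ones brings \<open>r\<close>
  new vertices, and its image is one of at most \<open>n * d\<close> edges; the extra factor
  \<open>n\<close> is accounted for by the extra vertex.
\<close>

lemma card_forest_embeddings:
  assumes N: "finite N" and r: "r \<ge> 1" and H: "H \<subseteq> [N]\<^bsup>r\<^esup>"
    and deg: "\<forall>v\<in>N. card {e \<in> H. v \<in> e} \<le> d"
    and "finite T" "forest T" "\<And>e. e \<in> T \<Longrightarrow> finite e \<and> card e = r"
  shows "card (embeddings N (\<Union>T) T H) * card N ^ ((r - 1) * card T)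
      \<le> (d * r ^ r) ^ card T * card N ^ card (\<Union>T)"
  using assms(5-7)
proof (induction "card T" arbitrary: T)
  case 0
  then show ?case by (simp add: embeddings_def)
next
  case (Suc t)
  have "T \<noteq> {}" using Suc.hyps(2) by auto
  then obtain e where e: "e \<in> T"
    and leaf: "\<And>u v. u \<in> e \<inter> \<Union>(T - {e}) \<Longrightarrow> v \<in> e \<inter> \<Union>(T - {e}) \<Longrightarrow> u = v"
    using exists_leaf_edge[OF Suc.prems(1) _ Suc.prems(2)] by blast
  define R where "R = T - {e}"
  define V where "V = \<Union>R"
  have R: "card R = t" "finite R" "forest R" "\<And>e. e \<in> R \<Longrightarrow> finite e \<and> card e = r"
    using e Suc.hyps(2) Suc.prems has_cycle_mono[of R T] by (auto simp: R_def forest_def)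
  have IH: "card (embeddings N V R H) * card N ^ ((r - 1) * t) \<le> (d * r ^ r) ^ t * card N ^ card V"
    using Suc.hyps(1)[of R] R unfolding V_def by simp
  have fe: "finite e" "card e = r" using e Suc.prems(3) by auto
  have fV: "finite V" using R by (auto simp: V_def)
  have UT: "\<Union>T = V \<union> e" using e by (auto simp: V_def R_def)
  have finH: "finite H" using H N by (meson finite_imp_finite_nsets finite_subset)
  have Hr: "D \<subseteq> N" "finite D" "card D = r" if "D \<in> H" for D using that H by (auto simp: nsets_def)
  let ?C = "\<lambda>g. {D \<in> H. \<forall>u\<in>e \<inter> V. g u \<in> D}"
  have finE: "finite (embeddings N V R H)"
    unfolding embeddings_def using fV N by (simp add: finite_PiE)
  \<comment> \<open>Bounds the number of candidates for the image of \<open>e\<close>; the exponent is 1 exactly when \<open>e\<close> is disjoint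
    from \<open>V\<close>.\<close>
  define b where "b = card N ^ (1 - card (e \<inter> V)) * d"
  have "card (e \<inter> V) \<le> 1"
  proof (cases "e \<inter> V = {}")
    case False
    then obtain u where "u \<in> e \<inter> V" by blast
    then have "e \<inter> V = {u}" using leaf unfolding V_def R_def by blast
    then show ?thesis by simp
  qed simp
  then have b: "card (?C g) \<le> b" if g: "g \<in> embeddings N V R H" for g
  proof (cases "e \<inter> V = {}")
    case True
    then show ?thesis using card_edges_le[OF N r H deg] by (simp add: b_def)
  next
    case False
    then obtain u where u: "u \<in> e \<inter> V" by blast
    then have "e \<inter> V = {u}" using leaf unfolding V_def R_def by blast
    moreover have "g u \<in> N" using g u by (auto simp: embeddings_def)
    ultimately show ?thesis using deg by (simp add: b_def)
  qed
  let ?F = "\<lambda>f. (restrict f V, restrict f e)"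
  let ?S = "SIGMA g:embeddings N V R H. \<Union>D\<in>?C g. e \<rightarrow>\<^sub>E D"
  have finS: "finite ?S"
    using finE finH Hr(2) fe by (intro finite_SigmaI finite_UN_I finite_PiE) auto
  have "card (embeddings N (\<Union>T) T H) \<le> card ?S"
  proof (rule card_inj_on_le[OF _ _ finS])
    show "inj_on ?F (embeddings N (\<Union>T) T H)"
    proof (rule inj_onI)
      fix f g assume *: "f \<in> embeddings N (\<Union>T) T H" "g \<in> embeddings N (\<Union>T) T H" "?F f = ?F g"
      show "f = g"
      proof (rule PiE_ext)
        show "f \<in> \<Union>T \<rightarrow>\<^sub>E N" "g \<in> \<Union>T \<rightarrow>\<^sub>E N" using * by (auto simp: embeddings_def)
        fix x assume "x \<in> \<Union>T"
        then consider "x \<in> V" | "x \<in> e" using UT by auto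
        then show "f x = g x" using *(3) by cases (metis Pair_inject restrict_apply')+
      qed
    qed
    show "?F ` embeddings N (\<Union>T) T H \<subseteq> ?S"
    proof (rule image_subsetI)
      fix f assume f: "f \<in> embeddings N (\<Union>T) T H"
      have RV: "D \<subseteq> V" if "D \<in> R" for D using that by (auto simp: V_def)
      have "restrict f V ` D = f ` D" if "D \<in> R" for D
        using RV[OF that] by (intro image_cong) auto
      then have "restrict f V \<in> embeddings N V R H"
        using f UT unfolding embeddings_def by (auto simp: R_def inj_on_def)
      moreover have "f ` e \<in> ?C (restrict f V)" using f e by (auto simp: embeddings_def)
      moreover have "restrict f e \<in> e \<rightarrow>\<^sub>E f ` e" by auto
      ultimately show "?F f \<in> ?S" by blast
    qed
  qed
  also have "card ?S = (\<Sum>g\<in>embeddings N V R H. card (\<Union>D\<in>?C g. e \<rightarrow>\<^sub>E D))"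
    using finE finH Hr(2) fe by (intro card_SigmaI ballI finite_UN_I finite_PiE) auto
  also have "\<dots> \<le> (\<Sum>g\<in>embeddings N V R H. b * r ^ r)"
  proof (rule sum_mono)
    fix g assume g: "g \<in> embeddings N V R H"
    have "card (\<Union>D\<in>?C g. e \<rightarrow>\<^sub>E D) \<le> card (?C g) * r ^ r"
      using finH Hr(3) fe by (intro card_extensions_le) auto
    also have "\<dots> \<le> b * r ^ r" using b[OF g] by simp
    finally show "card (\<Union>D\<in>?C g. e \<rightarrow>\<^sub>E D) \<le> b * r ^ r" .
  qed
  also have "\<dots> = card (embeddings N V R H) * (b * r ^ r)" by simp
  finally have step: "card (embeddings N (\<Union>T) T H) \<le> card (embeddings N V R H) * (b * r ^ r)" .
  have "card (V \<union> e) + card (e \<inter> V) = card V + r"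
    using card_Un_Int[OF fV fe(1)] fe(2) by (simp add: Int_commute)
  then have vert: "(1 - card (e \<inter> V)) + (r - 1) + card V = card (\<Union>T)"
    using \<open>card (e \<inter> V) \<le> 1\<close> r UT by auto
  have "card (embeddings N (\<Union>T) T H) * card N ^ ((r - 1) * card T)
     \<le> card (embeddings N V R H) * (b * r ^ r) * card N ^ ((r - 1) * Suc t)"
    using step Suc.hyps(2) by simp
  also have "\<dots> = card (embeddings N V R H) * card N ^ ((r - 1) * t) * (b * r ^ r * card N ^ (r - 1))"
    by (simp add: power_add mult_ac)
  also have "\<dots> \<le> (d * r ^ r) ^ t * card N ^ card V * (b * r ^ r * card N ^ (r - 1))"
    using IH by (rule mult_right_mono) simp
  also have "\<dots> = (d * r ^ r) ^ card T * card N ^ ((1 - card (e \<inter> V)) + (r - 1) + card V)"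
    unfolding b_def Suc.hyps(2)[symmetric] by (simp add: power_add mult_ac)
  finally show ?case unfolding vert .
qed

text \<open>
  By induction on \<open>v\<close>: replacing \<open>n\<close> by \<open>m = n - 1\<close> and
  \<open>v\<close> by \<open>v - 1\<close> changes the ratio of the two sides by
  \<open>(1 + 1 / m) ^ (v - 1)\<close>, which is at most \<open>exp 1\<close>. The bound compares
  all maps from \<open>v\<close> points into \<open>n\<close> points with the injective ones.
\<close>

lemma power_fact_le:
  assumes "v \<le> n"
  shows "real n ^ v * fact (n - v) \<le> exp 1 ^ v * fact n"
  using assms
proof (induction v arbitrary: n)
  case (Suc v)
  then obtain m where n: "n = Suc m" by (cases n) auto
  show ?case
  proof (cases "m = 0")
    case True
    then show ?thesis using Suc.prems n by simp
  next
    case False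
    have "real n ^ v = real m ^ v * (1 + 1 / m) ^ v"
      using False by (simp add: n field_simps flip: power_mult_distrib)
    also have "(1 + 1 / real m) ^ v \<le> (1 + 1 / real m) ^ m"
      using Suc.prems n by (intro power_increasing) auto
    also have "\<dots> \<le> exp (1 / real m) ^ m"
      by (intro power_mono exp_ge_add_one_self) simp
    also have "\<dots> = exp 1" using False by (simp flip: exp_of_nat_mult)
    finally have *: "real n ^ v \<le> real m ^ v * exp 1" by (simp add: mult_left_mono)
    have "real n ^ Suc v * fact (n - Suc v) \<le> real n * (real m ^ v * exp 1) * fact (m - v)"
      using * by (simp add: n mult_right_mono mult_left_mono)
    also have "\<dots> = real n * exp 1 * (real m ^ v * fact (m - v))" by simp
    also have "\<dots> \<le> real n * exp 1 * (exp 1 ^ v * fact m)"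
      using Suc.IH[of m] Suc.prems n by (intro mult_left_mono) auto
    also have "\<dots> = exp 1 ^ Suc v * fact n" by (simp add: n)
    finally show ?thesis .
  qed
qed simp

text \<open>
  Composing with the inverse of one such permutation leaves permutations of the complement of
  \<open>V\<close>.
\<close>

lemma card_permutations_agreeing:
  assumes N: "finite N" and V: "V \<subseteq> N"
  shows "card {s. s permutes N \<and> restrict s V = f} \<le> fact (card N - card V)"
proof (cases "{s. s permutes N \<and> restrict s V = f} = {}")
  case False
  then obtain s0 where s0: "s0 permutes N" "restrict s0 V = f" by blast
  have fin: "finite {s. s permutes (N - V)}" using N by (simp add: finite_permutations)
  have "card {s. s permutes N \<and> restrict s V = f} \<le> card {s. s permutes (N - V)}"
  proof (rule card_inj_on_le[OF _ _ fin])
    show "inj_on (\<lambda>s. inv s0 \<circ> s) {s. s permutes N \<and> restrict s V = f}"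
      using permutes_bij[OF s0(1)]
      by (intro inj_onI) (metis (no_types, lifting) bij_is_surj comp_assoc id_comp surj_iff)
    show "(\<lambda>s. inv s0 \<circ> s) ` {s. s permutes N \<and> restrict s V = f} \<subseteq> {s. s permutes (N - V)}"
    proof clarify
      fix s assume s: "s permutes N" "f = restrict s V"
      have "inv s0 \<circ> s permutes N" using s s0 by (simp add: permutes_compose permutes_inv)
      moreover have "(inv s0 \<circ> s) x = x" if "x \<in> V" for x
      proof -
        have "s x = s0 x" using s s0 that by (metis restrict_apply')
        then show ?thesis using permutes_inverses(2)[OF s0(1)] by simp
      qed
      ultimately show "inv s0 \<circ> s permutes (N - V)" by (rule permutes_superset) auto
    qed
  qed
  also have "\<dots> = fact (card N - card V)"
    using N V by (subst card_permutations) (auto simp: card_Diff_subset finite_subset)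
  finally show ?thesis .
next
  case True
  show ?thesis unfolding True by simp
qed

text \<open>
  Each embedding of the forest extends to at most \<open>(n - v)!\<close> permutations, where
  \<open>v\<close> is its number of vertices. Since \<open>v \<le> r * card T\<close>, comparing
  \<open>(n - v)! * n ^ v\<close> with \<open>n!\<close> costs at most \<open>exp 1 ^ r\<close>
  per edge.
\<close>

lemma card_permutations_forest:
  assumes N: "finite N" and r: "r \<ge> 1" and H: "H \<subseteq> [N]\<^bsup>r\<^esup>"
    and deg: "\<forall>v\<in>N. card {e \<in> H. v \<in> e} \<le> d"
    and T: "T \<subseteq> [N]\<^bsup>r\<^esup>" "forest T"
  shows "card {s. s permutes N \<and> (\<forall>e\<in>T. s ` e \<in> H)} * real (card N) ^ ((r - 1) * card T)
      \<le> (d * (r * exp 1) ^ r) ^ card T * fact (card N)"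
proof -
  have finT: "finite T" using T N by (meson finite_imp_finite_nsets finite_subset)
  have Tr: "finite e \<and> card e = r" "e \<subseteq> N" if "e \<in> T" for e using that T by (auto simp: nsets_def)
  let ?V = "\<Union>T" and ?P = "{s. s permutes N \<and> (\<forall>e\<in>T. s ` e \<in> H)}"
  let ?E = "embeddings N ?V T H"
  have VN: "?V \<subseteq> N" using Tr by auto
  have fV: "finite ?V" using VN N finite_subset by blast
  have finE: "finite ?E" unfolding embeddings_def using fV N by (simp add: finite_PiE)
  have "?P \<subseteq> (\<Union>f\<in>?E. {s. s permutes N \<and> restrict s ?V = f})"
  proof
    fix s assume s: "s \<in> ?P"
    have "restrict s ?V \<in> ?E"
      unfolding embeddings_def
    proof (intro CollectI conjI ballI)
      show "restrict s ?V \<in> ?V \<rightarrow>\<^sub>E N" using s VN by (auto simp: permutes_in_image)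
      show "inj_on (restrict s ?V) ?V"
        using s permutes_inj[of s N] by (auto simp: inj_on_def)
      fix e assume e: "e \<in> T"
      then have "restrict s ?V ` e = s ` e" by (intro image_cong) auto
      then show "restrict s ?V ` e \<in> H" using s e by auto
    qed
    then show "s \<in> (\<Union>f\<in>?E. {s. s permutes N \<and> restrict s ?V = f})" using s by blast
  qed
  then have "card ?P \<le> card (\<Union>f\<in>?E. {s. s permutes N \<and> restrict s ?V = f})"
    using finE N by (intro card_mono finite_UN_I)
      (auto intro: finite_subset[OF _ finite_permutations])
  also have "\<dots> \<le> (\<Sum>f\<in>?E. card {s. s permutes N \<and> restrict s ?V = f})"
    using finE by (rule card_UN_le)
  also have "\<dots> \<le> (\<Sum>f\<in>?E. fact (card N - card ?V))"
    by (intro sum_mono card_permutations_agreeing N VN)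
  finally have "card ?P \<le> card ?E * fact (card N - card ?V)" by simp
  then have "real (card ?P) \<le> real (card ?E * fact (card N - card ?V))"
    by (simp only: of_nat_le_iff)
  then have 1: "real (card ?P) \<le> card ?E * fact (card N - card ?V)" by simp
  have "real (card ?E * card N ^ ((r - 1) * card T)) \<le> real ((d * r ^ r) ^ card T * card N ^ card ?V)"
    unfolding of_nat_le_iff using Tr
    by (intro card_forest_embeddings[OF N r H deg finT T(2)]) auto
  then have 2: "real (card ?E) * card N ^ ((r - 1) * card T) \<le> (d * r ^ r) ^ card T * real (card N) ^ card ?V"
    by simp
  have 3: "card ?V \<le> r * card T"
  proof -
    have "card ?V \<le> (\<Sum>e\<in>T. card e)" using card_UN_le[OF finT, of "\<lambda>e. e"] by simp
    also have "\<dots> = r * card T" using Tr by simp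
    finally show ?thesis .
  qed
  have "card ?P * real (card N) ^ ((r - 1) * card T)
      \<le> (card ?E * fact (card N - card ?V)) * real (card N) ^ ((r - 1) * card T)"
    using 1 by (intro mult_right_mono) auto
  also have "\<dots> = (real (card ?E) * card N ^ ((r - 1) * card T)) * fact (card N - card ?V)" by simp
  also have "\<dots> \<le> ((d * r ^ r) ^ card T * real (card N) ^ card ?V) * fact (card N - card ?V)"
    using 2 by (intro mult_right_mono) auto
  also have "\<dots> = (d * r ^ r) ^ card T * (real (card N) ^ card ?V * fact (card N - card ?V))" by simp
  also have "\<dots> \<le> (d * r ^ r) ^ card T * (exp 1 ^ card ?V * fact (card N))"
    using VN N by (intro mult_left_mono power_fact_le card_mono) auto
  also have "\<dots> \<le> (d * r ^ r) ^ card T * (exp 1 ^ (r * card T) * fact (card N))"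
    using 3 by (intro mult_left_mono mult_right_mono power_increasing) auto
  also have "\<dots> = (d * (r * exp 1) ^ r) ^ card T * fact (card N)"
    by (simp add: power_mult power_mult_distrib)
  finally show ?thesis .
qed

section \<open>Spread of the copies of a hypergraph\<close>

lemma large_forest_in_subgraph:
  assumes "finite H" "F \<subseteq> H" "F \<noteq> {}"
  shows "\<exists>T\<subseteq>F. forest T \<and> real (card F) - card T \<le> phi H * card F"
proof -
  have F: "finite F" using assms finite_subset by auto
  let ?R = "{card T |T. T \<subseteq> F \<and> forest T}"
  have "forest {}" unfolding forest_def has_cycle_def by force
  then have "?R \<noteq> {}" by blast
  moreover have "finite ?R" using F by (simp add: setcompr_eq_image)
  ultimately have "rho F \<in> ?R" unfolding rho_def by (intro Max_in)
  then obtain T where T: "T \<subseteq> F" "forest T" "rho F = card T" by auto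
  have "1 - real (rho F) / real (card F) \<le> phi H"
    unfolding phi_def using assms by (intro Max_ge) (auto simp: setcompr_eq_image)
  moreover have "card F > 0" using F assms(3) by (simp add: card_gt_0_iff)
  ultimately have "real (card F) - card T \<le> phi H * card F"
    by (simp add: T(3) field_simps)
  then show ?thesis using T by blast
qed

text \<open>
  If one permutation maps \<open>F \<subseteq> H\<close> onto \<open>S\<close>, then composing it
  with inverses turns permutations that put \<open>S\<close> inside the image of \<open>H\<close>
  into permutations that map \<open>F\<close>, hence a largest forest \<open>T\<close> of
  \<open>F\<close>, into \<open>H\<close>. This gives the bound \<open>y ^ card T\<close> in place
  of \<open>y ^ card S\<close>. By the hypothesis on \<^const>\<open>phi\<close> the exponents
  differ by at most \<open>c * card S / ln n\<close>, and
  \<open>1 / y \<le> n ^ (r - 1) = exp ((r - 1) * ln n)\<close>, so the loss is at most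
  \<open>exp ((r - 1) * c)\<close> per edge of \<open>S\<close>: the logarithms cancel.
\<close>

lemma permuted_copies_spread:
  fixes c y :: real
  assumes N: "finite N" "card N \<ge> 2" and r: "r \<ge> 1" and H: "H \<subseteq> [N]\<^bsup>r\<^esup>"
    and deg: "\<forall>v\<in>N. card {e \<in> H. v \<in> e} \<le> d" and d: "d \<ge> 1"
    and phi: "phi H \<le> c / ln (card N)"
    and y: "y = d * (r * exp 1) ^ r / real (card N) ^ (r - 1)" "y \<le> 1"
  shows "card {s. s permutes N \<and> S \<subseteq> (`) s ` H} \<le> fact (card N) * (exp (real (r - 1) * c) * y) ^ card S"
proof (cases "S = {} \<or> {s. s permutes N \<and> S \<subseteq> (`) s ` H} = {}")
  case True
  have "real d * (real r * exp 1) ^ r \<ge> 0" by simp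
  then have "y \<ge> 0" unfolding y(1) by simp
  with True show ?thesis
  proof (elim disjE)
    assume "{s. s permutes N \<and> S \<subseteq> (`) s ` H} = {}"
    then show ?thesis using \<open>y \<ge> 0\<close> by (simp only: card.empty) simp
  qed (use N in \<open>simp add: card_permutations\<close>)
next
  case False
  then obtain s0 where s0: "s0 permutes N" "S \<subseteq> (`) s0 ` H" by blast
  let ?n = "real (card N)"
  have finH: "finite H" using H N by (meson finite_imp_finite_nsets finite_subset)
  define F where "F = {e \<in> H. s0 ` e \<in> S}"
  have SF: "S = (`) s0 ` F" using s0(2) by (auto simp: F_def)
  have "inj_on ((`) s0) F"
    using permutes_inj[OF s0(1)] by (meson inj_on_def inj_image_eq_iff)
  then have cF: "card F = card S" by (simp add: SF card_image)
  have "S \<noteq> {}" using False by simp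
  then have F: "F \<subseteq> H" "F \<noteq> {}" unfolding SF by (auto simp: F_def)
  obtain T where T: "T \<subseteq> F" "forest T" "real (card F) - card T \<le> phi H * card F"
    using large_forest_in_subgraph[OF finH F] by blast
  have tF: "card T \<le> card F" using T(1) F(1) finH by (meson card_mono finite_subset)
  have n: "?n \<ge> 2" "ln ?n > 0" using N by auto
  have "(real (card F) - card T) \<le> c / ln ?n * card F"
    using T(3) phi by (meson mult_right_mono of_nat_0_le_iff order_trans)
  then have gap: "real (card F - card T) * ln ?n \<le> c * card F"
    using n(2) tF by (simp add: field_simps of_nat_diff)
  let ?Q = "{s. s permutes N \<and> (\<forall>e\<in>T. s ` e \<in> H)}"
  have "card {s. s permutes N \<and> S \<subseteq> (`) s ` H} \<le> card ?Q"
  proof (rule card_inj_on_le)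
    show "finite ?Q" using N by (auto intro: finite_subset[OF _ finite_permutations[OF N(1)]])
    show "inj_on (\<lambda>s. inv s \<circ> s0) {s. s permutes N \<and> S \<subseteq> (`) s ` H}"
    proof (rule inj_onI, clarify)
      fix s t assume st: "s permutes N" "t permutes N" "inv s \<circ> s0 = inv t \<circ> s0"
      then have "inv s = inv t"
        by (metis comp_assoc comp_id permutes_inv_o(1) s0(1))
      then show "s = t" using st by (metis permutes_inv_inv)
    qed
    show "(\<lambda>s. inv s \<circ> s0) ` {s. s permutes N \<and> S \<subseteq> (`) s ` H} \<subseteq> ?Q"
    proof (rule image_subsetI, intro CollectI conjI ballI)
      fix s assume "s \<in> {s. s permutes N \<and> S \<subseteq> (`) s ` H}"
      then have s: "s permutes N" "S \<subseteq> (`) s ` H" by auto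
      then show "inv s \<circ> s0 permutes N" using s0(1) by (intro permutes_compose permutes_inv)
      fix e assume "e \<in> T"
      then have "s0 ` e \<in> S" using T(1) by (auto simp: F_def)
      then obtain e' where e': "e' \<in> H" "s0 ` e = s ` e'" using s(2) by auto
      have "(inv s \<circ> s0) ` e = inv s ` s ` e'" unfolding image_comp[symmetric] e'(2) ..
      also have "\<dots> = e'" using permutes_inj[OF s(1)] by (rule image_inv_f_f)
      finally show "(inv s \<circ> s0) ` e \<in> H" using e'(1) by simp
    qed
  qed
  then have "card {s. s permutes N \<and> S \<subseteq> (`) s ` H} \<le> real (card ?Q)" by simp
  also have "\<dots> \<le> fact (card N) * y ^ card T"
  proof -
    have "T \<subseteq> [N]\<^bsup>r\<^esup>" using T(1) F(1) H by blast
    then have "card ?Q * ?n ^ ((r - 1) * card T) \<le> (d * (r * exp 1) ^ r) ^ card T * fact (card N)"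
      by (rule card_permutations_forest[OF N(1) r H deg _ T(2)])
    moreover have "?n ^ ((r - 1) * card T) > 0" using n by simp
    ultimately have "card ?Q \<le> (d * (r * exp 1) ^ r) ^ card T * fact (card N) / ?n ^ ((r - 1) * card T)"
      by (simp add: pos_le_divide_eq)
    then show ?thesis
      unfolding y(1) power_divide power_mult[symmetric] by (simp add: mult.commute)
  qed
  also have "\<dots> \<le> fact (card N) * (exp (real (r - 1) * c) * y) ^ card S"
  proof (rule mult_left_mono)
    have "1 \<le> real r * exp 1" using r one_le_exp_iff[of 1] by (intro mult_ge1_I) auto
    then have "1 \<le> real d * (real r * exp 1) ^ r" using d one_le_power[OF \<open>1 \<le> real r * exp 1\<close>, of r] by (intro mult_ge1_I) auto
    moreover have yn: "y * ?n ^ (r - 1) = d * (r * exp 1) ^ r" using n by (simp add: y(1))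
    ultimately have "1 \<le> y * ?n ^ (r - 1)" by (simp only: yn)
    moreover from this have "0 < y" using n by (intro zero_less_mult_pos2[of y "?n ^ (r - 1)"]) auto
    ultimately have y0: "1 \<le> y * ?n ^ (r - 1)" "0 < y" by blast+
    have "1 \<le> (y * ?n ^ (r - 1)) ^ (card F - card T)" using y0(1) by (rule one_le_power)
    also have "\<dots> = y ^ (card F - card T) * exp (real (r - 1) * (real (card F - card T) * ln ?n))"
    proof -
      have "(?n ^ (r - 1)) ^ k = exp (real (r - 1) * (real k * ln ?n))" for k
      proof -
        have "(?n ^ (r - 1)) ^ k = exp (ln ?n) ^ ((r - 1) * k)" using n by (simp add: power_mult)
        also have "\<dots> = exp (real ((r - 1) * k) * ln ?n)" by (rule exp_of_nat_mult[symmetric])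
        finally show ?thesis by (simp only: of_nat_mult mult.assoc)
      qed
      then show ?thesis by (simp only: power_mult_distrib)
    qed
    also have "\<dots> \<le> y ^ (card F - card T) * exp (real (r - 1) * (c * card F))"
      using gap y0(2) by (intro mult_left_mono) (auto intro: mult_left_mono)
    finally have "1 \<le> y ^ (card F - card T) * exp (real (r - 1) * (c * card F))" .
    then have "y ^ card T * 1 \<le> y ^ card T * (y ^ (card F - card T) * exp (real (r - 1) * (c * card F)))"
      using y0(2) by (intro mult_left_mono) auto
    also have "\<dots> = y ^ card F * exp (real (r - 1) * (c * card F))"
      using tF by (simp flip: mult.assoc power_add)
    also have "\<dots> = (exp (real (r - 1) * c) * y) ^ card S"
      by (simp add: cF power_mult_distrib mult_ac flip: exp_of_nat_mult)
    finally show "y ^ card T \<le> (exp (real (r - 1) * c) * y) ^ card S" by simp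
  qed simp
  finally show ?thesis .
qed

text \<open>
  Ensures \<open>ln n > 0\<close>; for \<open>n = 1\<close> the hypothesis on
  \<^const>\<open>phi\<close> would divide by 0.
\<close>

lemma two_le_ground_set:
  assumes "H \<subseteq> [N]\<^bsup>r\<^esup>" "card H \<ge> 2" "r \<ge> 1" "finite N"
  shows "card N \<ge> 2"
proof (rule ccontr)
  assume "\<not> card N \<ge> 2"
  have "e = N" if "e \<in> H" for e
  proof (rule card_seteq)
    show "e \<subseteq> N" "finite N" "card N \<le> card e"
      using that assms \<open>\<not> card N \<ge> 2\<close> by (auto simp: nsets_def)
  qed
  then have "H \<subseteq> {N}" by auto
  then have "card H \<le> card {N}" by (intro card_mono) auto
  then show False using assms(2) by simp
qed

theorem theorem7p1:
  fixes r :: nat and c :: real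
  assumes "r \<ge> 1" and "c > 0"
  shows "\<exists>K::real. \<forall>(n::nat) (d::nat) (H :: nat set set).
    n \<ge> 1 \<longrightarrow> d \<ge> 1 \<longrightarrow> H \<subseteq> [{1..n}]\<^bsup>r\<^esup> \<longrightarrow> card H \<ge> 2 \<longrightarrow>
    max_degree {1..n} H \<le> d \<longrightarrow> phi H \<le> c / ln (real n) \<longrightarrow>
    threshold ([{1..n}]\<^bsup>r\<^esup>) (containing_copy {1..n} r H)
      < K * real d / real n ^ (r - 1) * ln (real (card H))"
proof (intro exI allI impI)
  fix n d :: nat and H :: "nat set set"
  assume d: "d \<ge> 1" and H: "H \<subseteq> [{1..n}]\<^bsup>r\<^esup>" and card_H: "card H \<ge> 2"
    and deg: "max_degree {1..n} H \<le> d" and phi: "phi H \<le> c / ln (real n)"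
  let ?N = "{1..n}" and ?X = "[{1..n}]\<^bsup>r\<^esup>"
  let ?F = "containing_copy ?N r H" and ?A = "{s. s permutes ?N}"
  define y where "y = d * (r * exp 1) ^ r / real (card ?N) ^ (r - 1)"
  define z where "z = exp (real (r - 1) * c) * y"
  have n: "card ?N \<ge> 2" using two_le_ground_set[OF H card_H assms(1)] by simp
  have X: "finite ?X" by (simp add: finite_imp_finite_nsets)
  have y: "0 < y" using d assms(1) n by (auto simp: y_def intro!: divide_pos_pos mult_pos_pos)
  have copy: "(`) s ` H \<in> ?F" if "s permutes ?N" for s
  proof -
    have bij: "bij_betw s ?N ?N" using that by (rule permutes_imp_bij)
    have "(`) s ` H \<subseteq> ?X"
    proof (rule image_subsetI)
      fix e assume "e \<in> H"
      then have e: "e \<subseteq> ?N" "finite e" "card e = r" using H by (auto simp: nsets_def)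
      have "s ` e \<subseteq> ?N" using e(1) that by (auto simp only: permutes_in_image)
      moreover have "card (s ` e) = r"
        using e(3) permutes_inj[OF that] by (simp add: card_image inj_on_subset)
      ultimately show "s ` e \<in> ?X" using e(2) by (simp add: nsets_def)
    qed
    then show ?thesis
      using bij unfolding containing_copy_def copies_def isomorphic_on_def by blast
  qed
  have "threshold ?X ?F < 64 * z * ln (card H)"
  proof (rule spread_threshold[OF X])
    show "?F \<subseteq> Pow ?X" "\<forall>S\<in>?F. \<forall>T. S \<subseteq> T \<longrightarrow> T \<subseteq> ?X \<longrightarrow> T \<in> ?F"
      unfolding containing_copy_def by blast+
    have "H \<noteq> {}" using card_H by auto
    then show "{} \<notin> ?F" by (auto simp: containing_copy_def copies_def isomorphic_on_def)
    have "H \<in> ?F" using copy[OF permutes_id] by simp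
    then show "?X \<in> ?F" using H by (auto simp: containing_copy_def)
    show "finite ?A" by (simp add: finite_permutations)
    show "?A \<noteq> {}" using permutes_id by blast
    show "(`) s ` H \<in> ?F \<and> card ((`) s ` H) \<le> card H" if "s \<in> ?A" for s
      using that copy card_image_le[OF finite_subset[OF H X]] by blast
    show "0 < z" using y by (simp add: z_def)
    fix U assume "16 * z \<le> 1"
    have "1 * y \<le> z"
      unfolding z_def using y assms(2) by (intro mult_right_mono) auto
    then have "y \<le> 1" using \<open>16 * z \<le> 1\<close> y by linarith
    moreover have "\<forall>v\<in>?N. card {e \<in> H. v \<in> e} \<le> d"
    proof
      fix v assume "v \<in> ?N"
      then have "card {e \<in> H. v \<in> e} \<le> max_degree ?N H"
        unfolding max_degree_def by (intro Max_ge) auto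
      then show "card {e \<in> H. v \<in> e} \<le> d" using deg by simp
    qed
    ultimately have "card {s. s permutes ?N \<and> U \<subseteq> (`) s ` H} \<le> fact (card ?N) * z ^ card U"
      unfolding z_def using phi
      by (intro permuted_copies_spread[OF _ n assms(1) H _ d _ y_def]) auto
    then show "card {s \<in> ?A. U \<subseteq> (`) s ` H} \<le> card ?A * z ^ card U"
      by (simp add: card_permutations)
  qed (use card_H in auto)
  \<comment> \<open>The constant is read off from \<open>64 * z\<close>; its factors depend only on \<open>r\<close> and \<open>c\<close>.\<close>
  then show "threshold ?X ?F
      < (64 * (exp (real (r - 1) * c) * (r * exp 1) ^ r)) * real d / real n ^ (r - 1) * ln (real (card H))"
    by (simp add: z_def y_def mult_ac)
qed

end
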